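(* Let $\mathcal{H},\mathcal{K}$ be complex Hilbert spaces. Let $V_1,\ldots,V_d \in B(\mathcal{H})$ be commuting isometries and let $W_1,\ldots,W_d \in B(\mathcal{K})$ be commuting co-isometries. Let $H_1,\ldots,H_d \in B(\mathcal{H},\mathcal{K})$ be operators satisfying $H_i V_j = W_j H_i$ for $i,j=1,\ldots,d$. Let $r_1, \ldots,r_d \in [0,1]$ and assume that the commuting operators $$T_j = \begin{bmatrix} r_j V_j & 0 \\ H_j & r_j W_j \end{bmatrix} \in B(\mathcal{H} \oplus \mathcal{K}), \qquad j=1,\dots,d,$$ are contractions. Then $$\|p(T_1,\ldots,T_d)\| \le (d+1) \|p\|_\infty$$ for all $p \in \mathbb{C}[z_1,\ldots,z_d]$.
   Context: $\|p\|_\infty=\sup_{z\in\mathbb{D}^d}|p(z)|$, where $\mathbb{D}$ is the open unit disc. A co-isometry is an operator whose adjoint is an isometry; a contraction is an operator of norm at most $1$. *)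

theory Defs
  imports "HOL-Analysis.Analysis" "HOL-Library.Poly_Mapping"
begin

section \<open>Complex Hilbert spaces\<close>

class scaleC =
  fixes scaleC :: "complex \<Rightarrow> 'a \<Rightarrow> 'a"  (infixr \<open>*\<^sub>C\<close> 75)

class complex_vector = scaleC + real_vector +
  assumes scaleC_add_right: "a *\<^sub>C (x + y) = a *\<^sub>C x + a *\<^sub>C y"
    and scaleC_add_left: "(a + b) *\<^sub>C x = a *\<^sub>C x + b *\<^sub>C x"
    and scaleC_scaleC: "a *\<^sub>C b *\<^sub>C x = (a * b) *\<^sub>C x"
    and scaleC_one: "1 *\<^sub>C x = x"
    and scaleR_scaleC: "r *\<^sub>R x = complex_of_real r *\<^sub>C x"

text \<open>
  The complex inner product is linear in its first argument.  The real inner product of the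
  superclass is its real part, so that the norm is \<open>sqrt (Re (cinner x x))\<close> and all results about
  real inner product spaces apply.
\<close>

class complex_inner = complex_vector + real_inner +
  fixes cinner :: "'a \<Rightarrow> 'a \<Rightarrow> complex"
  assumes cinner_commute: "cinner x y = cnj (cinner y x)"
    and cinner_add_left: "cinner (x + y) z = cinner x z + cinner y z"
    and cinner_scaleC_left: "cinner (c *\<^sub>C x) y = c * cinner x y"
    and inner_eq_Re_cinner: "inner x y = Re (cinner x y)"

class chilbert_space = complex_inner + complete_space

instantiation complex :: chilbert_space
begin

definition scaleC_complex :: "complex \<Rightarrow> complex \<Rightarrow> complex"
  where "scaleC_complex c z = c * z"

definition cinner_complex :: "complex \<Rightarrow> complex \<Rightarrow> complex"
  where "cinner_complex z w = z * cnj w"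

instance
  by standard
    (auto simp: scaleC_complex_def cinner_complex_def inner_complex_def scaleR_conv_of_real
      algebra_simps)

end

text \<open>
  The Hilbert space direct sum is the product type: the norm from the library is
  \<open>norm (x, y) = sqrt ((norm x)\<^sup>2 + (norm y)\<^sup>2)\<close>.
\<close>

instantiation prod :: (complex_vector, complex_vector) complex_vector
begin

definition scaleC_prod :: "complex \<Rightarrow> 'a \<times> 'b \<Rightarrow> 'a \<times> 'b"
  where "scaleC_prod c u = (c *\<^sub>C fst u, c *\<^sub>C snd u)"

instance
  by standard
    (auto simp: scaleC_prod_def scaleC_add_right scaleC_add_left scaleC_scaleC scaleC_one
      scaleR_scaleC prod_eq_iff)

end

instantiation prod :: (complex_inner, complex_inner) complex_inner
begin

definition cinner_prod :: "'a \<times> 'b \<Rightarrow> 'a \<times> 'b \<Rightarrow> complex"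
  where "cinner_prod u v = cinner (fst u) (fst v) + cinner (snd u) (snd v)"

instance
proof
  fix x y z :: "'a \<times> 'b" and c :: complex
  show "cinner x y = cnj (cinner y x)"
    unfolding cinner_prod_def by (metis cinner_commute complex_cnj_add)
qed (auto simp: cinner_prod_def scaleC_prod_def cinner_add_left cinner_scaleC_left
      inner_prod_def inner_eq_Re_cinner algebra_simps)

end

instance prod :: (chilbert_space, chilbert_space) chilbert_space ..


section \<open>Operators\<close>

definition bounded_clinear :: "('a::complex_inner \<Rightarrow> 'b::complex_inner) \<Rightarrow> bool"
  where "bounded_clinear A \<longleftrightarrow> bounded_linear A \<and> (\<forall>c x. A (c *\<^sub>C x) = c *\<^sub>C A x)"

definition contraction :: "('a::complex_inner \<Rightarrow> 'b::complex_inner) \<Rightarrow> bool"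
  where "contraction A \<longleftrightarrow> bounded_clinear A \<and> onorm A \<le> 1"

definition lin_isometry :: "('a::complex_inner \<Rightarrow> 'b::complex_inner) \<Rightarrow> bool"
  where "lin_isometry A \<longleftrightarrow> bounded_clinear A \<and> (\<forall>x. norm (A x) = norm x)"

definition cadjoint :: "('a::complex_inner \<Rightarrow> 'b::complex_inner) \<Rightarrow> 'b \<Rightarrow> 'a"
  where "cadjoint A = (THE B. \<forall>x y. cinner (A x) y = cinner x (B y))"

definition lin_coisometry :: "('a::complex_inner \<Rightarrow> 'b::complex_inner) \<Rightarrow> bool"
  where "lin_coisometry A \<longleftrightarrow> bounded_clinear A \<and> lin_isometry (cadjoint A)"

text \<open>The Riesz representation theorem, showing that \<^const>\<open>cadjoint\<close> is the Hilbert space adjoint.\<close>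

lemma riesz_representation_real:
  fixes g :: "'a::{real_inner, complete_space} \<Rightarrow> real"
  assumes g: "bounded_linear g"
  shows "\<exists>y. \<forall>x. g x = inner x y"
proof -
  interpret g: bounded_linear g by (rule g)
  define q where "q x = inner x x - 2 * g x" for x
  define M where "M = onorm g"
  have "q x \<ge> - M\<^sup>2" for x
  proof -
    have "g x \<le> M * norm x"
      using onorm[OF g, of x] unfolding M_def by auto
    moreover have "0 \<le> (norm x - M)\<^sup>2" by simp
    ultimately show ?thesis
      unfolding q_def power2_norm_eq_inner[symmetric] power2_diff by (simp add: mult.commute)
  qed
  then have bdd: "bdd_below (range q)" by (auto intro!: bdd_belowI)
  define I where "I = (INF x. q x)"
  have I_le: "I \<le> q x" for x
    unfolding I_def by (intro cINF_lower bdd) auto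
  have "\<exists>x. q x < I + inverse (real (Suc n))" for n
  proof -
    have "(INF x. q x) < I + inverse (real (Suc n))" by (simp add: I_def)
    then show ?thesis using bdd by (subst (asm) cINF_less_iff) auto
  qed
  then obtain X where X: "\<And>n. q (X n) < I + inverse (real (Suc n))" by metis
  have par: "(dist x y)\<^sup>2 \<le> 2 * (q x - I) + 2 * (q y - I)" for x y
  proof -
    have "(dist x y)\<^sup>2 = 2 * q x + 2 * q y - 4 * q ((1/2) *\<^sub>R (x + y))"
      unfolding dist_norm power2_norm_eq_inner q_def g.scaleR g.add
      by (simp add: inner_commute algebra_simps)
    moreover have "I \<le> q ((1/2) *\<^sub>R (x + y))" by (rule I_le)
    ultimately show ?thesis by (simp add: algebra_simps)
  qed
  have "Cauchy X"
  proof (rule metric_CauchyI)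
    fix e :: real assume e: "0 < e"
    obtain N where N: "inverse (real (Suc N)) < e\<^sup>2 / 4"
      using reals_Archimedean[of "e\<^sup>2 / 4"] e by auto
    have small: "q (X n) - I < e\<^sup>2 / 4" if "n \<ge> N" for n
    proof -
      have "inverse (real (Suc n)) \<le> inverse (real (Suc N))"
        using that by (intro le_imp_inverse_le) auto
      with X[of n] N show ?thesis by linarith
    qed
    show "\<exists>N. \<forall>m\<ge>N. \<forall>n\<ge>N. dist (X m) (X n) < e"
    proof (intro exI allI impI)
      fix m n assume "N \<le> m" "N \<le> n"
      then have "q (X m) - I < e\<^sup>2 / 4" "q (X n) - I < e\<^sup>2 / 4" by (blast intro: small)+
      with par[of "X m" "X n"] have "(dist (X m) (X n))\<^sup>2 < e\<^sup>2"
        by (simp add: field_simps)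
      then show "dist (X m) (X n) < e"
        using e by (meson less_imp_le power_less_imp_less_base)
    qed
  qed
  then obtain y where y: "X \<longlonglongrightarrow> y"
    using Cauchy_convergent convergent_def by blast
  have "(\<lambda>n. q (X n)) \<longlonglongrightarrow> q y"
    unfolding q_def by (intro tendsto_intros y g.tendsto)
  moreover have "(\<lambda>n. I + inverse (real (Suc n))) \<longlonglongrightarrow> I + 0"
    by (intro tendsto_intros LIMSEQ_inverse_real_of_nat)
  ultimately have "q y \<le> I + 0"
    by (rule LIMSEQ_le) (use X less_imp_le in blast)
  then have min: "q y \<le> q x" for x using I_le[of x] by simp
  have "g x = inner x y" for x
  proof -
    define a where "a = inner x y - g x"
    define b where "b = inner x x"
    have b: "b \<ge> 0" by (simp add: b_def)
    define t where "t = - a / (b + 1)"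
    have "q (y + t *\<^sub>R x) = q y + 2 * t * a + t\<^sup>2 * b"
      unfolding q_def g.add g.scaleR a_def b_def
      by (simp add: inner_commute algebra_simps power2_eq_square)
    with min[of "y + t *\<^sub>R x"] have "0 \<le> 2 * t * a + t\<^sup>2 * b" by simp
    also have "2 * t * a + t\<^sup>2 * b = - (a\<^sup>2 * (b + 2)) / (b + 1)\<^sup>2"
      using b unfolding t_def by (simp add: divide_simps power2_eq_square) algebra
    finally have "a\<^sup>2 * (b + 2) \<le> 0"
      using b by (simp add: divide_le_0_iff zero_le_divide_iff)
    with b have "a = 0" by (auto simp: mult_le_0_iff)
    then show ?thesis by (simp add: a_def)
  qed
  then show ?thesis by blast
qed

lemma cinner_eq_inner:
  "cinner x y = Complex (inner x y) (- inner (\<i> *\<^sub>C x) y)"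
  by (simp add: complex_eq_iff inner_eq_Re_cinner cinner_scaleC_left)

lemma cadjoint_works:
  fixes A :: "'a::chilbert_space \<Rightarrow> 'b::complex_inner"
  assumes A: "bounded_clinear A"
  shows "cinner (A x) y = cinner x (cadjoint A y)"
proof -
  have lin: "bounded_linear A" and iA: "A (\<i> *\<^sub>C x) = \<i> *\<^sub>C A x" for x
    using A by (auto simp: bounded_clinear_def)
  have "\<exists>z. \<forall>x. inner (A x) y = inner x z" for y
    by (intro riesz_representation_real bounded_linear_compose[OF bounded_linear_inner_left lin])
  then obtain B where "\<And>x y. inner (A x) y = inner x (B y)" by metis
  then have B: "\<forall>x y. cinner (A x) y = cinner x (B y)"
    by (simp add: cinner_eq_inner iA[symmetric])
  have "\<forall>x y. cinner (A x) y = cinner x (cadjoint A y)"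
    unfolding cadjoint_def
  proof (rule theI[where a = B and P = "\<lambda>B. \<forall>x y. cinner (A x) y = cinner x (B y)"])
    show "\<forall>x y. cinner (A x) y = cinner x (B y)" by (rule B)
  next
    fix C assume "\<forall>x y. cinner (A x) y = cinner x (C y)"
    with B have "cinner x (B y) = cinner x (C y)" for x y by simp
    then have "inner x (B y) = inner x (C y)" for x y by (simp add: inner_eq_Re_cinner)
    then show "C = B" by (metis ext vector_eq_ldot)
  qed
  then show ?thesis by blast
qed

text \<open>
  \<open>block_op r V H W\<close> is the operator with block matrix rows \<open>(r V, 0)\<close> and \<open>(H, r W)\<close>.
\<close>

definition block_op ::
  "real \<Rightarrow> ('a \<Rightarrow> 'a) \<Rightarrow> ('a \<Rightarrow> 'b) \<Rightarrow> ('b \<Rightarrow> 'b) \<Rightarrow> 'a::complex_inner \<times> 'b::complex_inner \<Rightarrow> 'a \<times> 'b"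
  where "block_op r V H W = (\<lambda>(x, y). (r *\<^sub>R V x, H x + r *\<^sub>R W y))"

lemma block_op_commute:
  assumes "bounded_clinear V1" "bounded_clinear V2" "bounded_clinear H1" "bounded_clinear H2"
    "bounded_clinear W1" "bounded_clinear W2"
    and "V1 \<circ> V2 = V2 \<circ> V1" "W1 \<circ> W2 = W2 \<circ> W1"
    and "H1 \<circ> V2 = W2 \<circ> H1" "H2 \<circ> V1 = W1 \<circ> H2"
  shows "block_op r1 V1 H1 W1 \<circ> block_op r2 V2 H2 W2 = block_op r2 V2 H2 W2 \<circ> block_op r1 V1 H1 W1"
proof -
  have "linear V1" "linear V2" "linear H1" "linear H2" "linear W1" "linear W2"
    using assms(1-6) by (auto simp: bounded_clinear_def bounded_linear.linear)
  with assms(7-) show ?thesis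
    by (auto simp: block_op_def fun_eq_iff linear_add linear_scale scaleR_add_right mult.commute)
qed


section \<open>Polynomials in \<open>d\<close> variables\<close>

text \<open>
  Polynomials are finitely supported maps from exponent vectors to coefficients; the variables
  \<open>z\<^sub>1, \<dots>, z\<^sub>d\<close> carry the indices \<open>1, \<dots>, d\<close>.
\<close>

definition polys :: "nat \<Rightarrow> ((nat \<Rightarrow>\<^sub>0 nat) \<Rightarrow>\<^sub>0 complex) set"
  where "polys d = {p. \<forall>m\<in>Poly_Mapping.keys p. Poly_Mapping.keys m \<subseteq> {1..d}}"

definition poly_eval :: "nat \<Rightarrow> ((nat \<Rightarrow>\<^sub>0 nat) \<Rightarrow>\<^sub>0 complex) \<Rightarrow> (nat \<Rightarrow> complex) \<Rightarrow> complex"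
  where "poly_eval d p z =
    (\<Sum>m\<in>Poly_Mapping.keys p. Poly_Mapping.lookup p m * (\<Prod>i\<in>{1..d}. z i ^ Poly_Mapping.lookup m i))"

text \<open>
  The factors are composed in the order \<open>T\<^sub>1\<^bsup>m\<^sub>1\<^esup> \<circ> \<dots> \<circ> T\<^sub>d\<^bsup>m\<^sub>d\<^esup>\<close>; for commuting operators
  the order is irrelevant.
\<close>

definition monom_op :: "nat \<Rightarrow> (nat \<Rightarrow>\<^sub>0 nat) \<Rightarrow> (nat \<Rightarrow> 'a \<Rightarrow> 'a) \<Rightarrow> 'a \<Rightarrow> 'a"
  where "monom_op d m T = foldr (\<lambda>i A. (T i ^^ Poly_Mapping.lookup m i) \<circ> A) [1..<Suc d] id"

definition poly_op ::
  "nat \<Rightarrow> ((nat \<Rightarrow>\<^sub>0 nat) \<Rightarrow>\<^sub>0 complex) \<Rightarrow> (nat \<Rightarrow> 'a \<Rightarrow> 'a) \<Rightarrow> 'a \<Rightarrow> 'a::complex_vector"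
  where "poly_op d p T x = (\<Sum>m\<in>Poly_Mapping.keys p. Poly_Mapping.lookup p m *\<^sub>C monom_op d m T x)"

lemma bounded_clinear_poly_op:
  fixes T :: "nat \<Rightarrow> 'a::complex_inner \<Rightarrow> 'a"
  assumes T: "\<And>i. i \<in> {1..d} \<Longrightarrow> bounded_clinear (T i)"
  shows "bounded_clinear (poly_op d p T)"
proof -
  have comp: "bounded_clinear (A \<circ> B)" if "bounded_clinear A" "bounded_clinear B"
    for A B :: "'a \<Rightarrow> 'a"
    using that by (auto simp: bounded_clinear_def o_def intro: bounded_linear_compose)
  have id: "bounded_clinear (id :: 'a \<Rightarrow> 'a)"
    by (auto simp: bounded_clinear_def id_def intro: bounded_linear_ident)
  have pow: "bounded_clinear (A ^^ n)" if "bounded_clinear A" for A :: "'a \<Rightarrow> 'a" and n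
    by (induction n) (auto simp del: comp_apply intro: comp that id[unfolded id_def] id)
  have fold: "bounded_clinear (foldr (\<lambda>i A. (T i ^^ k i) \<circ> A) xs id)"
    if "set xs \<subseteq> {1..d}" for xs k
    using that by (induction xs) (auto intro!: comp pow T id)
  have mon: "bounded_clinear (monom_op d m T)" for m
    unfolding monom_op_def by (rule fold) auto
  have scale_eq: "norm (c *\<^sub>C x) = cmod c * norm x" for c and x :: 'a
  proof -
    have "cinner (c *\<^sub>C x) (c *\<^sub>C x) = c * cnj c * cinner x x"
      by (subst cinner_scaleC_left, subst cinner_commute, subst cinner_scaleC_left)
        (simp add: cinner_commute[symmetric])
    then have "inner (c *\<^sub>C x) (c *\<^sub>C x) = (cmod c)\<^sup>2 * inner x x"
      by (simp add: inner_eq_Re_cinner complex_norm_square[symmetric] del: of_real_power)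
    then show ?thesis
      by (simp add: norm_eq_sqrt_inner real_sqrt_mult)
  qed
  have scale: "bounded_linear (\<lambda>x::'a. c *\<^sub>C x)" for c
    by (rule bounded_linear_intro[where K = "cmod c"])
      (simp_all add: scaleC_add_right scaleR_scaleC scaleC_scaleC scale_eq mult.commute)
  have scale_sum: "c *\<^sub>C sum f S = (\<Sum>i\<in>S. c *\<^sub>C f i)" for c and f :: "_ \<Rightarrow> 'a" and S
    using linear_sum[OF bounded_linear.linear[OF scale]] .
  show ?thesis
    using mon unfolding bounded_clinear_def poly_op_def[abs_def]
    by (auto intro!: bounded_linear_sum bounded_linear_compose[OF scale]
        simp: scale_sum scaleC_scaleC mult.commute)
qed

definition polydisc :: "nat \<Rightarrow> (nat \<Rightarrow> complex) set"
  where "polydisc d = {1..d} \<rightarrow>\<^sub>E ball 0 1"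

definition poly_norm :: "nat \<Rightarrow> ((nat \<Rightarrow>\<^sub>0 nat) \<Rightarrow>\<^sub>0 complex) \<Rightarrow> real"
  where "poly_norm d p = (SUP z\<in>polydisc d. cmod (poly_eval d p z))"

text \<open>The supremum in \<^const>\<open>poly_norm\<close> is over a nonempty set of reals that is bounded above.\<close>

lemma polydisc_nonempty: "polydisc d \<noteq> {}"
  by (auto simp: polydisc_def PiE_eq_empty_iff)

lemma bdd_above_poly_eval: "bdd_above ((\<lambda>z. cmod (poly_eval d p z)) ` polydisc d)"
proof (rule bdd_aboveI2)
  fix z assume "z \<in> polydisc d"
  then have z: "cmod (z i) \<le> 1" if "i \<in> {1..d}" for i
    using that by (force simp: polydisc_def PiE_iff)
  have "cmod (\<Prod>i\<in>{1..d}. z i ^ Poly_Mapping.lookup m i) \<le> 1" for m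
    unfolding prod_norm[symmetric] norm_power by (intro prod_le_1) (auto intro!: power_le_one z)
  then show "cmod (poly_eval d p z) \<le> (\<Sum>m\<in>Poly_Mapping.keys p. cmod (Poly_Mapping.lookup p m))"
    unfolding poly_eval_def
    by (intro order_trans[OF norm_sum] sum_mono) (simp add: norm_mult mult_left_le)
qed

end

theory Submission
  imports Defs "HOL-Complex_Analysis.Complex_Analysis"
begin

text \<open>
  The operator \<open>p(T)\<close> is lower triangular with diagonal entries \<open>p(rV)\<close>, \<open>p(rW)\<close> and, because of
  \<open>H\<^sub>i V\<^sub>j = W\<^sub>j H\<^sub>i\<close>, corner entry \<open>\<Sum>\<^sub>j H\<^sub>j (\<partial>\<^sub>j p)(rV)\<close>.  Commuting families of isometries and of
  co-isometries satisfy von Neumann's inequality.  Hence the diagonal contributes \<open>\<parallel>p\<parallel>\<^sub>\<infinity>\<close>; moreover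
  \<open>\<parallel>(\<partial>\<^sub>j p)(rV)\<parallel> \<le> \<parallel>p\<parallel>\<^sub>\<infinity> / (1 - r\<^sub>j\<^sup>2)\<close> by the Schwarz--Pick estimate, while contractivity of \<open>T\<^sub>j\<close> forces
  \<open>\<parallel>H\<^sub>j\<parallel> \<le> 1 - r\<^sub>j\<^sup>2\<close>, so each of the \<open>d\<close> terms in the corner contributes at most \<open>\<parallel>p\<parallel>\<^sub>\<infinity>\<close>.

  Von Neumann's inequality needs no dilation theory: it suffices to replace one operator at a time by
  a unimodular scalar.  For this, apply the discrete Fourier transform to a long orbit segment of an
  isometry \<open>U\<close> (or of the adjoint of a co-isometry) and let the length tend to infinity.
\<close>

section \<open>Complex inner product spaces and bounded operators\<close>

lemma scaleC_zero_right [simp]: "c *\<^sub>C (0::'a::complex_vector) = 0"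
  using scaleC_add_right[of c "0::'a" 0] by simp

lemma scaleC_zero_left [simp]: "0 *\<^sub>C (x::'a::complex_vector) = 0"
  using scaleC_add_left[of 0 0 x] by simp

lemma scaleC_sum_right: "c *\<^sub>C sum f S = (\<Sum>i\<in>S. c *\<^sub>C (f i :: 'a::complex_vector))"
  by (induction S rule: infinite_finite_induct) (simp_all add: scaleC_add_right)

lemma cinner_add_right: "cinner x (y + z) = cinner x y + cinner x (z::'a::complex_inner)"
  by (metis cinner_add_left cinner_commute complex_cnj_add)

lemma cinner_scaleC_right: "cinner x (c *\<^sub>C y) = cnj c * cinner x (y::'a::complex_inner)"
  by (metis cinner_commute cinner_scaleC_left complex_cnj_mult)

lemma cinner_sum_left: "cinner (sum f S) (y::'a::complex_inner) = (\<Sum>i\<in>S. cinner (f i) y)"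
proof -
  have "cinner 0 y = 0" using cinner_scaleC_left[of 0 0 y] by simp
  then show ?thesis
    by (induction S rule: infinite_finite_induct) (simp_all add: cinner_add_left)
qed

lemma cinner_sum_right: "cinner (x::'a::complex_inner) (sum f S) = (\<Sum>i\<in>S. cinner x (f i))"
proof -
  have "cinner x 0 = 0" using cinner_scaleC_right[of x 0 0] by simp
  then show ?thesis
    by (induction S rule: infinite_finite_induct) (simp_all add: cinner_add_right)
qed

lemma cinner_self: "cinner x x = complex_of_real ((norm (x::'a::complex_inner))\<^sup>2)"
proof -
  have "Im (cinner x x) = 0"
    using arg_cong[OF cinner_commute[of x x], of Im] by simp
  then show ?thesis
    by (simp add: complex_eq_iff power2_norm_eq_inner inner_eq_Re_cinner del: of_real_power)
qed

lemma norm_scaleC: "norm (c *\<^sub>C (x::'a::complex_inner)) = cmod c * norm x"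
proof -
  have "complex_of_real ((norm (c *\<^sub>C x))\<^sup>2) = complex_of_real ((cmod c * norm x)\<^sup>2)"
    unfolding cinner_self[symmetric] cinner_scaleC_left cinner_scaleC_right
    by (simp add: cinner_self power_mult_distrib complex_norm_square[of c] mult.commute
        del: of_real_power)
  then show ?thesis
    by (metis of_real_eq_iff norm_ge_zero power2_eq_imp_eq mult_nonneg_nonneg)
qed

lemma bounded_clinear_add: "bounded_clinear A \<Longrightarrow> A (x + y) = A x + A y"
  by (simp add: bounded_clinear_def bounded_linear.linear linear_add)

lemma bounded_clinear_scaleC: "bounded_clinear A \<Longrightarrow> A (c *\<^sub>C x) = c *\<^sub>C A x"
  by (simp add: bounded_clinear_def)

lemma bounded_clinear_scaleR: "bounded_clinear A \<Longrightarrow> A (c *\<^sub>R x) = c *\<^sub>R A x"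
  by (simp add: bounded_clinear_def bounded_linear.linear linear_scale)

lemma bounded_clinear_sum_apply: "bounded_clinear A \<Longrightarrow> A (sum f S) = (\<Sum>i\<in>S. A (f i))"
  by (simp add: bounded_clinear_def bounded_linear.linear linear_sum)

lemma bounded_clinear_id: "bounded_clinear id"
  by (auto simp: bounded_clinear_def id_def bounded_linear_ident)

lemma bounded_clinear_compose:
  "bounded_clinear A \<Longrightarrow> bounded_clinear B \<Longrightarrow> bounded_clinear (A \<circ> B)"
  by (auto simp: bounded_clinear_def o_def bounded_linear_compose)

lemma bounded_clinear_funpow:
  fixes A :: "'a::complex_inner \<Rightarrow> 'a"
  shows "bounded_clinear A \<Longrightarrow> bounded_clinear (A ^^ n)"
  by (induction n) (simp_all add: bounded_clinear_compose bounded_clinear_id del: id_apply)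

lemma bounded_clinear_scaleC_compose:
  fixes A :: "'a::complex_inner \<Rightarrow> 'b::complex_inner"
  shows "bounded_clinear A \<Longrightarrow> bounded_clinear (\<lambda>x. c *\<^sub>C A x)"
proof -
  have "bounded_linear (\<lambda>x::'b. c *\<^sub>C x)"
    by (rule bounded_linear_intro[where K = "cmod c"])
      (simp_all add: scaleC_add_right scaleR_scaleC scaleC_scaleC norm_scaleC mult.commute)
  then show "bounded_clinear A \<Longrightarrow> bounded_clinear (\<lambda>x. c *\<^sub>C A x)"
    by (auto simp: bounded_clinear_def scaleC_scaleC mult.commute
        intro: bounded_linear_compose[of "(*\<^sub>C) c" A])
qed

section \<open>Von Neumann's inequality\<close>

text \<open>Off the diagonal this is a geometric sum whose ratio \<open>u\<close> satisfies
  \<open>u ^ N = 1\<close>. The ratio is not 1, because \<open>k - l\<close> is nonzero and smaller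
  than \<open>N\<close> in absolute value, so it is no multiple of \<open>N\<close>.\<close>

lemma sum_roots_of_unity_orthogonal:
  fixes N k l :: nat
  assumes k: "k < N" and l: "l < N"
  defines "\<omega> \<equiv> \<lambda>j::nat. cis (2 * pi * real j / real N)"
  shows "(\<Sum>j<N. \<omega> j ^ k * cnj (\<omega> j ^ l)) = (if k = l then of_nat N else 0)"
proof (cases "k = l")
  case True
  have "\<omega> j ^ k * cnj (\<omega> j ^ k) = 1" for j
    unfolding complex_norm_square[symmetric] by (simp add: \<omega>_def norm_power)
  then show ?thesis using True by simp
next
  case False
  define t where "t = 2 * pi * (real k - real l) / real N"
  define u where "u = cis t"
  have N: "real N > 0" using k by simp
  have "\<omega> j ^ k * cnj (\<omega> j ^ l) = u ^ j" for j
    unfolding \<omega>_def u_def t_def Complex.DeMoivre cis_cnj cis_mult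
    using N by (intro arg_cong[of _ _ cis]) (simp add: diff_divide_distrib algebra_simps)
  moreover have "u ^ N = 1"
  proof -
    have "u ^ N = cis (2 * pi * of_int (int k - int l))"
      unfolding u_def t_def Complex.DeMoivre using N by (intro arg_cong[of _ _ cis]) simp
    then show ?thesis by (simp add: complex_eq_iff)
  qed
  moreover have "u \<noteq> 1"
  proof
    assume "u = 1"
    then have "cos t = 1" by (simp add: u_def complex_eq_iff)
    then obtain n :: int where "t = of_int n * 2 * pi" by (auto simp: cos_one_2pi_int)
    then have "real k - real l = of_int n * real N"
      using N by (simp add: t_def divide_eq_eq)
    then have n: "int k - int l = n * int N"
      by (metis of_int_diff of_int_eq_iff of_int_mult of_int_of_nat_eq)
    then have "n \<noteq> 0" using False by auto
    then have "int N \<le> \<bar>n * int N\<bar>"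
      using mult_right_mono[of 1 "\<bar>n\<bar>" "int N"] by (simp add: abs_mult)
    then show False using n k l by linarith
  qed
  ultimately show ?thesis using False by (simp add: geometric_sum)
qed

text \<open>Expanding the squared norms gives inner products of \<open>b k\<close> and
  \<open>b l\<close>; summing over \<open>j\<close> first, orthogonality leaves only the terms with
  \<open>k = l\<close>.\<close>

lemma parseval_roots_of_unity:
  fixes b :: "nat \<Rightarrow> 'a::complex_inner" and N :: nat
  defines "\<omega> \<equiv> \<lambda>j::nat. cis (2 * pi * real j / real N)"
  shows "(\<Sum>j<N. (norm (\<Sum>k<N. \<omega> j ^ k *\<^sub>C b k))\<^sup>2) = real N * (\<Sum>k<N. (norm (b k))\<^sup>2)"
proof -
  have "complex_of_real (\<Sum>j<N. (norm (\<Sum>k<N. \<omega> j ^ k *\<^sub>C b k))\<^sup>2) =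
      (\<Sum>j<N. \<Sum>k<N. \<Sum>l<N. \<omega> j ^ k * cnj (\<omega> j ^ l) * cinner (b k) (b l))"
    unfolding of_real_sum cinner_self[symmetric] cinner_sum_left cinner_scaleC_left
    by (simp only: cinner_sum_right cinner_scaleC_right sum_distrib_left mult.assoc)
  also have "\<dots> = (\<Sum>k<N. \<Sum>j<N. \<Sum>l<N. \<omega> j ^ k * cnj (\<omega> j ^ l) * cinner (b k) (b l))"
    by (rule sum.swap)
  also have "\<dots> = (\<Sum>k<N. \<Sum>l<N. \<Sum>j<N. \<omega> j ^ k * cnj (\<omega> j ^ l) * cinner (b k) (b l))"
    by (intro sum.cong refl sum.swap)
  also have "\<dots> = (\<Sum>k<N. \<Sum>l<N. (if k = l then of_nat N else 0) * cinner (b k) (b l))"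
    unfolding sum_distrib_right[symmetric]
    by (intro sum.cong refl arg_cong2[where f = "(*)"])
      (simp add: \<omega>_def sum_roots_of_unity_orthogonal del: complex_cnj_power)
  also have "\<dots> = complex_of_real (real N * (\<Sum>k<N. (norm (b k))\<^sup>2))"
    by (simp add: if_distrib[of "\<lambda>x. x * _"] sum.delta cinner_self sum_distrib_left cong: if_cong)
  finally show ?thesis by (simp only: of_real_eq_iff)
qed

section \<open>Transference from unimodular scalars to sequences of vectors\<close>

text \<open>The inner sum on the left is a convolution of \<open>a\<close>. The Fourier transform
  turns the shift by \<open>e i\<close> into multiplication by the \<open>e i\<close>-th power of a
  root of unity, so \<open>bound\<close> applies at each frequency, and Parseval on both sides
  transfers the estimate back. The window \<open>{D..<M}\<close> contains only indices
  \<open>l\<close> at which every \<open>l - e i\<close> lies in the range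
  \<open>{..<M}\<close>.\<close>

lemma transference_sum:
  fixes B :: "'i \<Rightarrow> 'a::complex_inner \<Rightarrow> 'b::complex_inner" and a :: "nat \<Rightarrow> 'a"
  assumes B: "\<And>i. i \<in> I \<Longrightarrow> bounded_clinear (B i)"
    and D: "\<And>i. i \<in> I \<Longrightarrow> e i \<le> D"
    and bound: "\<And>z v. cmod z = 1 \<Longrightarrow> norm (\<Sum>i\<in>I. z ^ e i *\<^sub>C B i v) \<le> C * norm v"
  shows "(\<Sum>l\<in>{D..<M}. (norm (\<Sum>i\<in>I. B i (a (l - e i))))\<^sup>2) \<le> C\<^sup>2 * (\<Sum>k<M. (norm (a k))\<^sup>2)"
proof (cases "M = 0")
  case False
  txt \<open>With \<open>N\<close>-th roots of unity for this \<open>N\<close>, the cyclic convolution below does not wrap around.\<close>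
  define N where "N = M + D"
  have N: "0 < real N" using False by (simp add: N_def)
  define \<omega> where "\<omega> j = cis (2 * pi * real j / real N)" for j :: nat
  define a' where "a' k = (if k < M then a k else 0)" for k
  define b where "b l = (\<Sum>i\<in>I. if e i \<le> l then B i (a' (l - e i)) else 0)" for l
  define ah where "ah j = (\<Sum>k<N. \<omega> j ^ k *\<^sub>C a' k)" for j
  have B0: "B i 0 = 0" if "i \<in> I" for i
    using bounded_clinear_sum_apply[OF B[OF that], of "\<lambda>_. 0" "{}"] by simp
  have conv: "(\<Sum>l<N. \<omega> j ^ l *\<^sub>C b l) = (\<Sum>i\<in>I. \<omega> j ^ e i *\<^sub>C B i (ah j))" for j
  proof -
    have "(\<Sum>l<N. \<omega> j ^ l *\<^sub>C b l) =
        (\<Sum>i\<in>I. \<Sum>l<N. \<omega> j ^ l *\<^sub>C (if e i \<le> l then B i (a' (l - e i)) else 0))"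
      unfolding b_def scaleC_sum_right by (rule sum.swap)
    also have "\<dots> = (\<Sum>i\<in>I. \<omega> j ^ e i *\<^sub>C B i (ah j))"
    proof (rule sum.cong[OF refl])
      fix i assume i: "i \<in> I"
      \<comment> \<open>The truncated sequence \<open>a'\<close> vanishes from \<open>M\<close> on,
        so only the translate of \<open>{..<M}\<close> by \<open>e i\<close> contributes, and it
        fits below \<open>N\<close> because \<open>e i \<le> D\<close>.\<close>
      have "(\<Sum>l<N. \<omega> j ^ l *\<^sub>C (if e i \<le> l then B i (a' (l - e i)) else 0)) =
          (\<Sum>l\<in>(\<lambda>k. k + e i) ` {..<M}. \<omega> j ^ l *\<^sub>C B i (a' (l - e i)))"
        using D[OF i]
        by (intro sum.mono_neutral_cong_right)
          (auto simp: N_def a'_def B0[OF i] image_iff intro: le_add_diff_inverse2[symmetric])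
      also have "\<dots> = (\<Sum>k<M. \<omega> j ^ (k + e i) *\<^sub>C B i (a' k))"
        by (subst sum.reindex) (auto simp: inj_on_def)
      also have "\<dots> = (\<Sum>k<N. \<omega> j ^ (k + e i) *\<^sub>C B i (a' k))"
        by (intro sum.mono_neutral_left) (auto simp: N_def a'_def B0[OF i])
      also have "\<dots> = \<omega> j ^ e i *\<^sub>C B i (ah j)"
        unfolding ah_def bounded_clinear_sum_apply[OF B[OF i]] bounded_clinear_scaleC[OF B[OF i]]
          scaleC_sum_right
        by (simp add: scaleC_scaleC power_add mult.commute)
      finally show "(\<Sum>l<N. \<omega> j ^ l *\<^sub>C (if e i \<le> l then B i (a' (l - e i)) else 0)) =
        \<omega> j ^ e i *\<^sub>C B i (ah j)" .
    qed
    finally show ?thesis .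
  qed
  have "(\<Sum>l\<in>{D..<M}. (norm (\<Sum>i\<in>I. B i (a (l - e i))))\<^sup>2) = (\<Sum>l\<in>{D..<M}. (norm (b l))\<^sup>2)"
  proof (rule sum.cong[OF refl])
    fix l assume l: "l \<in> {D..<M}"
    have "(\<Sum>i\<in>I. B i (a (l - e i))) = b l"
      unfolding b_def
    proof (rule sum.cong[OF refl])
      fix i assume "i \<in> I"
      then show "B i (a (l - e i)) = (if e i \<le> l then B i (a' (l - e i)) else 0)"
        using l D[of i] by (auto simp: a'_def)
    qed
    then show "(norm (\<Sum>i\<in>I. B i (a (l - e i))))\<^sup>2 = (norm (b l))\<^sup>2" by simp
  qed
  also have "\<dots> \<le> (\<Sum>l<N. (norm (b l))\<^sup>2)"
    by (intro sum_mono2) (auto simp: N_def)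
  finally have "real N * (\<Sum>l\<in>{D..<M}. (norm (\<Sum>i\<in>I. B i (a (l - e i))))\<^sup>2) \<le>
      real N * (\<Sum>l<N. (norm (b l))\<^sup>2)"
    using N by simp
  also have "\<dots> = (\<Sum>j<N. (norm (\<Sum>i\<in>I. \<omega> j ^ e i *\<^sub>C B i (ah j)))\<^sup>2)"
    unfolding conv[symmetric] unfolding \<omega>_def by (rule parseval_roots_of_unity[symmetric])
  also have "\<dots> \<le> (\<Sum>j<N. (C * norm (ah j))\<^sup>2)"
    by (intro sum_mono power_mono bound) (auto simp: \<omega>_def)
  also have "\<dots> = C\<^sup>2 * (\<Sum>j<N. (norm (ah j))\<^sup>2)"
    by (simp add: power_mult_distrib sum_distrib_left)
  also have "(\<Sum>j<N. (norm (ah j))\<^sup>2) = real N * (\<Sum>k<N. (norm (a' k))\<^sup>2)"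
    unfolding ah_def \<omega>_def by (rule parseval_roots_of_unity)
  also have "(\<Sum>k<N. (norm (a' k))\<^sup>2) = (\<Sum>k<M. (norm (a k))\<^sup>2)"
    by (intro sum.mono_neutral_cong_right) (auto simp: N_def a'_def)
  finally show ?thesis
    using N by (simp add: mult.left_commute)
qed simp

text \<open>The window has \<open>M - D\<close> terms of size at least that of \<open>y\<close>,
  against \<open>M\<close> terms of size at most that of \<open>x\<close>; the boundary loss
  \<open>D\<close> disappears as \<open>M\<close> tends to infinity. The sequence may depend on
  \<open>M\<close>, since an orbit of an isometry will be read backwards from the end of the
  segment.\<close>

lemma transference:
  fixes B :: "'i \<Rightarrow> 'a::complex_inner \<Rightarrow> 'a"
  assumes B: "\<And>i. i \<in> I \<Longrightarrow> bounded_clinear (B i)"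
    and D: "\<And>i. i \<in> I \<Longrightarrow> e i \<le> D"
    and bound: "\<And>z v. cmod z = 1 \<Longrightarrow> norm (\<Sum>i\<in>I. z ^ e i *\<^sub>C B i v) \<le> C * norm v"
    and C: "0 \<le> C"
    and a: "\<And>M k. k < M \<Longrightarrow> norm (a M k) \<le> norm x"
    and y: "\<And>M l. D \<le> l \<Longrightarrow> l < M \<Longrightarrow> norm y \<le> norm (\<Sum>i\<in>I. B i (a M (l - e i)))"
  shows "norm y \<le> C * norm x"
proof -
  \<comment> \<open>For \<open>M = n + D\<close> the window contains exactly \<open>n\<close>
    indices.\<close>
  have main: "real n * (norm y)\<^sup>2 \<le> real (n + D) * (C * norm x)\<^sup>2" for n
  proof -
    have "real n * (norm y)\<^sup>2 = (\<Sum>l\<in>{D..<n + D}. (norm y)\<^sup>2)" by simp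
    also have "\<dots> \<le> (\<Sum>l\<in>{D..<n + D}. (norm (\<Sum>i\<in>I. B i (a (n + D) (l - e i))))\<^sup>2)"
      by (intro sum_mono power_mono y) auto
    also have "\<dots> \<le> C\<^sup>2 * (\<Sum>k<n + D. (norm (a (n + D) k))\<^sup>2)"
      by (rule transference_sum[OF B D bound])
    also have "\<dots> \<le> C\<^sup>2 * (\<Sum>k<n + D. (norm x)\<^sup>2)"
      by (intro mult_left_mono sum_mono power_mono a) auto
    finally show ?thesis by (simp add: power_mult_distrib mult_ac)
  qed
  have "(norm y)\<^sup>2 \<le> (C * norm x)\<^sup>2"
  proof (rule LIMSEQ_le_const)
    have "(\<lambda>n. (1 + real D * inverse (real (Suc n))) * (C * norm x)\<^sup>2)
        \<longlonglongrightarrow> (1 + real D * 0) * (C * norm x)\<^sup>2"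
      by (intro tendsto_intros LIMSEQ_inverse_real_of_nat)
    then show "(\<lambda>n. (1 + real D * inverse (real (Suc n))) * (C * norm x)\<^sup>2)
        \<longlonglongrightarrow> (C * norm x)\<^sup>2" by simp
    have "(norm y)\<^sup>2 \<le> (1 + real D * inverse (real (Suc n))) * (C * norm x)\<^sup>2" for n
    proof -
      have "real (Suc n) * ((1 + real D * inverse (real (Suc n))) * (C * norm x)\<^sup>2) =
          real (Suc n + D) * (C * norm x)\<^sup>2"
        by (simp add: distrib_left flip: mult.assoc)
      then have "real (Suc n) * (norm y)\<^sup>2 \<le>
          real (Suc n) * ((1 + real D * inverse (real (Suc n))) * (C * norm x)\<^sup>2)"
        using main[of "Suc n"] by (simp only:)
      then show ?thesis by (simp only: mult_le_cancel_left_pos of_nat_0_less_iff zero_less_Suc)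
    qed
    then show "\<exists>N. \<forall>n\<ge>N. (norm y)\<^sup>2 \<le>
      (1 + real D * inverse (real (Suc n))) * (C * norm x)\<^sup>2" by blast
  qed
  then show ?thesis by (rule power2_le_imp_le) (simp add: C)
qed

section \<open>Von Neumann's inequality in one operator\<close>

text \<open>Stated for intertwiners so that it serves both for commuting operators, with
  \<open>U = W\<close>, and for the relation between the \<open>H j\<close>, \<open>V i\<close> and
  \<open>W i\<close>.\<close>

lemma funpow_commute_apply:
  assumes "A \<circ> U = W \<circ> A" shows "A ((U ^^ n) x) = (W ^^ n) (A x)"
  using assms by (induction n arbitrary: x) (auto simp: fun_eq_iff)

lemma coisometry_right_inverse:
  fixes W :: "'a::chilbert_space \<Rightarrow> 'b::chilbert_space"
  assumes "lin_coisometry W"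
  shows "W (cadjoint W y) = y" "norm (cadjoint W y) = norm y" "norm (W x) \<le> norm x"
proof -
  have W: "bounded_clinear W" and S: "bounded_clinear (cadjoint W)"
    and nS: "\<And>y. norm (cadjoint W y) = norm y"
    using assms by (auto simp: lin_coisometry_def lin_isometry_def)
  have adj: "inner (W x) y = inner x (cadjoint W y)" for x y
    using cadjoint_works[OF W] by (simp add: inner_eq_Re_cinner)
  \<comment> \<open>Polarization: the norms of \<open>u\<close>, \<open>v\<close> and
    \<open>u + v\<close> determine the real inner product.\<close>
  have inner_S: "inner (cadjoint W u) (cadjoint W v) = inner u v" for u v
    using nS[of "u + v"] unfolding bounded_clinear_add[OF S]
    by (simp add: norm_eq_sqrt_inner inner_add_left inner_add_right inner_commute
        nS[unfolded norm_eq_sqrt_inner, simplified])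
  show "W (cadjoint W y) = y"
    by (metis adj inner_S vector_eq_rdot)
  show "norm (cadjoint W y) = norm y" by (rule nS)
  have "(norm (W x))\<^sup>2 = inner x (cadjoint W (W x))"
    by (simp add: power2_norm_eq_inner adj)
  also have "\<dots> \<le> norm x * norm (W x)"
    using norm_cauchy_schwarz[of x "cadjoint W (W x)"] by (simp add: nS)
  finally show "norm (W x) \<le> norm x"
    by (metis mult_right_le_imp_le norm_ge_zero order_le_less power2_eq_square)
qed

lemma funpow_norm_le:
  fixes U :: "'a::real_normed_vector \<Rightarrow> 'a"
  assumes "\<And>x. norm (U x) \<le> norm x" shows "norm ((U ^^ n) x) \<le> norm x"
proof (induction n)
  case (Suc n)
  then show ?case using order_trans[OF assms, of "(U ^^ n) x"] by simp
qed simp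

lemma funpow_norm_eq:
  fixes U :: "'a::real_normed_vector \<Rightarrow> 'a"
  assumes "\<And>x. norm (U x) = norm x" shows "norm ((U ^^ n) x) = norm x"
  by (induction n) (simp_all add: assms)

text \<open>The task is to choose vectors \<open>a k\<close> such that each convolution sum, up to a
  common power of \<open>U\<close>, is the sum to be estimated. This power commutes with all
  \<open>B i\<close> and can be pulled out.\<close>

lemma von_neumann_one_variable:
  fixes B :: "'i \<Rightarrow> 'a::chilbert_space \<Rightarrow> 'a"
  assumes fin: "finite I" and U: "lin_isometry U \<or> lin_coisometry U"
    and B: "\<And>i. i \<in> I \<Longrightarrow> bounded_clinear (B i)"
    and comm: "\<And>i. i \<in> I \<Longrightarrow> B i \<circ> U = U \<circ> B i"
    and bound: "\<And>z v. cmod z = 1 \<Longrightarrow> norm (\<Sum>i\<in>I. z ^ e i *\<^sub>C B i v) \<le> C * norm v"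
    and C: "0 \<le> C"
  shows "norm (\<Sum>i\<in>I. B i ((U ^^ e i) x)) \<le> C * norm x"
proof -
  define D where "D = Max (insert 0 (e ` I))"
  have D: "e i \<le> D" if "i \<in> I" for i
    unfolding D_def using fin that by (intro Max_ge) auto
  have bU: "bounded_clinear (U ^^ n)" for n
    using U by (intro bounded_clinear_funpow) (auto simp: lin_isometry_def lin_coisometry_def)
  have shift: "(\<Sum>i\<in>I. B i ((U ^^ k) (v i))) = (U ^^ k) (\<Sum>i\<in>I. B i (v i))" for k v
    unfolding bounded_clinear_sum_apply[OF bU]
    by (intro sum.cong refl funpow_commute_apply comm)
  from U show ?thesis
  proof
    assume "lin_isometry U"
    then have nU: "norm ((U ^^ n) x) = norm x" for n x
      by (intro funpow_norm_eq) (simp add: lin_isometry_def)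
    show ?thesis
    \<comment> \<open>The orbit runs backwards: lowering the index by \<open>e i\<close> supplies
      \<open>e i\<close> additional powers of \<open>U\<close>. The common factor
      \<open>U ^^ (M - 1 - l)\<close> preserves norms.\<close>
    proof (rule transference[OF B D bound C, where a = "\<lambda>M k. (U ^^ (M - 1 - k)) x"])
      fix M l assume l: "D \<le> l" "l < M"
      have "(U ^^ (M - 1 - (l - e i))) x = (U ^^ (M - 1 - l)) ((U ^^ e i) x)" if "i \<in> I" for i
      proof -
        have "M - 1 - (l - e i) = (M - 1 - l) + e i" using D[OF that] l by simp
        then show ?thesis by (simp add: funpow_add)
      qed
      then have "(\<Sum>i\<in>I. B i ((U ^^ (M - 1 - (l - e i))) x)) =
          (\<Sum>i\<in>I. B i ((U ^^ (M - 1 - l)) ((U ^^ e i) x)))" by simp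
      then show "norm (\<Sum>i\<in>I. B i ((U ^^ e i) x)) \<le>
          norm (\<Sum>i\<in>I. B i ((U ^^ (M - 1 - (l - e i))) x))"
        by (simp add: shift nU)
    qed (simp_all add: nU)
  next
    assume co: "lin_coisometry U"
    define S where "S = cadjoint U"
    have US: "U (S y) = y" "norm (S y) = norm y" "norm (U y) \<le> norm y" for y
      unfolding S_def by (rule coisometry_right_inverse[OF co])+
    have pS: "(U ^^ n) ((S ^^ n) y) = y" for n y
    proof (induction n arbitrary: y)
      case (Suc n)
      have "(U ^^ Suc n) ((S ^^ Suc n) y) = (U ^^ n) (U (S ((S ^^ n) y)))"
        by (simp add: funpow_swap1)
      then show ?case by (simp add: US Suc)
    qed simp
    show ?thesis
    \<comment> \<open>The isometry \<open>S\<close> is a right inverse of \<open>U\<close>, so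
      \<open>U ^^ l\<close> maps \<open>(S ^^ (l - e i)) x\<close> to \<open>(U ^^ e i) x\<close>.
      Being a contraction, \<open>U ^^ l\<close> can only shrink the convolution sum, which is the
      direction needed.\<close>
    proof (rule transference[OF B D bound C, where a = "\<lambda>M k. (S ^^ k) x"])
      fix M l assume l: "D \<le> l" "l < M"
      have "(U ^^ l) ((S ^^ (l - e i)) x) = (U ^^ e i) x" if "i \<in> I" for i
      proof -
        have "l = e i + (l - e i)" using D[OF that] l by simp
        then have "(U ^^ l) ((S ^^ (l - e i)) x) =
            (U ^^ e i) ((U ^^ (l - e i)) ((S ^^ (l - e i)) x))"
          by (metis comp_apply funpow_add)
        then show ?thesis by (simp add: pS)
      qed
      then have "(\<Sum>i\<in>I. B i ((U ^^ e i) x)) = (U ^^ l) (\<Sum>i\<in>I. B i ((S ^^ (l - e i)) x))"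
        by (simp flip: shift)
      then show "norm (\<Sum>i\<in>I. B i ((U ^^ e i) x)) \<le> norm (\<Sum>i\<in>I. B i ((S ^^ (l - e i)) x))"
        by (simp add: funpow_norm_le US)
    qed (simp_all add: funpow_norm_eq US)
  qed
qed

section \<open>Von Neumann's inequality for commuting families\<close>

text \<open>The fold of \<open>monom_op\<close> over an arbitrary list, to allow induction on the
  variables, and with exponents given by a plain function, so that a single exponent can be lowered
  by function update.\<close>

definition mon :: "nat list \<Rightarrow> (nat \<Rightarrow> nat) \<Rightarrow> (nat \<Rightarrow> 'a \<Rightarrow> 'a) \<Rightarrow> 'a \<Rightarrow> 'a"
  where "mon xs m U = foldr (\<lambda>i A. (U i ^^ m i) \<circ> A) xs id"

lemma mon_Nil [simp]: "mon [] m U = id"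
  and mon_Cons: "mon (i # xs) m U x = (U i ^^ m i) (mon xs m U x)"
  by (simp_all add: mon_def)

lemma bounded_clinear_mon:
  assumes "\<And>i. i \<in> set xs \<Longrightarrow> bounded_clinear (U i)"
  shows "bounded_clinear (mon xs m U)"
  using assms
proof (induction xs)
  case (Cons i xs)
  then have "bounded_clinear ((U i ^^ m i) \<circ> mon xs m U)"
    by (intro bounded_clinear_compose bounded_clinear_funpow) auto
  also have "(U i ^^ m i) \<circ> mon xs m U = mon (i # xs) m U"
    by (simp add: fun_eq_iff mon_Cons)
  finally show ?case .
qed (simp add: bounded_clinear_id del: id_apply)

lemma mon_commute:
  assumes "\<And>i. i \<in> set xs \<Longrightarrow> A \<circ> U i = W i \<circ> A"
  shows "A (mon xs m U x) = mon xs m W (A x)"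
  using assms
proof (induction xs)
  case (Cons i xs)
  have "A ((U i ^^ m i) (mon xs m U x)) = (W i ^^ m i) (A (mon xs m U x))"
    by (intro funpow_commute_apply Cons.prems) simp
  then show ?case using Cons by (simp add: mon_Cons)
qed simp

text \<open>Induction on the variables: the one-operator inequality replaces \<open>U i\<close> by a
  unimodular scalar \<open>w\<close>, whose powers are absorbed into the coefficients; hence the
  induction is over arbitrary \<open>c\<close>. The map \<open>e\<close> may fail to be injective,
  as happens for the exponents of a partial derivative.\<close>

lemma von_neumann_commuting:
  fixes U :: "nat \<Rightarrow> 'a::chilbert_space \<Rightarrow> 'a"
  assumes fin: "finite I" and "distinct xs"
    and U: "\<And>i. i \<in> set xs \<Longrightarrow> lin_isometry (U i) \<or> lin_coisometry (U i)"
    and comm: "\<And>i j. i \<in> set xs \<Longrightarrow> j \<in> set xs \<Longrightarrow> U i \<circ> U j = U j \<circ> U i"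
    and bound: "\<And>z. (\<And>i. i \<in> set xs \<Longrightarrow> cmod (z i) = 1) \<Longrightarrow>
      cmod (\<Sum>m\<in>I. c m * (\<Prod>i\<in>set xs. z i ^ e m i)) \<le> C"
  shows "norm (\<Sum>m\<in>I. c m *\<^sub>C mon xs (e m) U x) \<le> C * norm x"
  using assms(2-)
proof (induction xs arbitrary: c x)
  case Nil
  have "(\<Sum>m\<in>I. c m *\<^sub>C x) = (\<Sum>m\<in>I. c m) *\<^sub>C x"
    by (induction I rule: infinite_finite_induct) (simp_all add: scaleC_add_left)
  then show ?case
    using Nil.prems(4) by (simp add: norm_scaleC mult_right_mono)
next
  case (Cons i xs)
  have bU: "bounded_clinear (U j)" if "j \<in> set (i # xs)" for j
    using Cons.prems(2)[OF that] by (auto simp: lin_isometry_def lin_coisometry_def)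
  have bm: "bounded_clinear (mon xs (e m) U)" for m
    by (intro bounded_clinear_mon bU) auto
  have cm: "(U i ^^ n) (mon xs (e m) U v) = mon xs (e m) U ((U i ^^ n) v)" for n m v
  proof (rule mon_commute)
    fix j assume "j \<in> set xs"
    then show "U i ^^ n \<circ> U j = U j \<circ> U i ^^ n"
      using funpow_commute_apply[of "U j" "U i" "U i" n, OF Cons.prems(3)] by (auto simp: fun_eq_iff)
  qed
  \<comment> \<open>The powers of \<open>U i\<close> are moved to the right, so that what remains in
    front can serve as the operator \<open>B m\<close>.\<close>
  have "norm (\<Sum>m\<in>I. c m *\<^sub>C mon xs (e m) U ((U i ^^ e m i) x)) \<le> C * norm x"
  proof (rule von_neumann_one_variable[where B = "\<lambda>m x. c m *\<^sub>C mon xs (e m) U x", OF fin])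
    show "lin_isometry (U i) \<or> lin_coisometry (U i)" using Cons.prems(2) by simp
    show "bounded_clinear (\<lambda>x. c m *\<^sub>C mon xs (e m) U x)" for m
      by (rule bounded_clinear_scaleC_compose[OF bm])
    show "(\<lambda>x. c m *\<^sub>C mon xs (e m) U x) \<circ> U i = U i \<circ> (\<lambda>x. c m *\<^sub>C mon xs (e m) U x)" for m
      using cm[of 1] by (simp add: fun_eq_iff bounded_clinear_scaleC[OF bU])
    show "0 \<le> C"
      using order_trans[OF norm_ge_zero Cons.prems(4)[of "\<lambda>_. 1"]] by simp
    fix w :: complex and v assume w: "cmod w = 1"
    have "norm (\<Sum>m\<in>I. (c m * w ^ e m i) *\<^sub>C mon xs (e m) U v) \<le> C * norm v"
    proof (rule Cons.IH)
      fix z assume z: "\<And>j. j \<in> set xs \<Longrightarrow> cmod (z j) = 1"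
      have i: "i \<notin> set xs" using Cons.prems(1) by simp
      have prod_eq: "(\<Prod>j\<in>set (i # xs). (z(i := w)) j ^ e m j) = w ^ e m i * (\<Prod>j\<in>set xs. z j ^ e m j)" for m
      proof -
        have "(\<Prod>j\<in>set xs. (z(i := w)) j ^ e m j) = (\<Prod>j\<in>set xs. z j ^ e m j)"
          using i by (intro prod.cong) auto
        then show ?thesis using i by simp
      qed
      then show "cmod (\<Sum>m\<in>I. c m * w ^ e m i * (\<Prod>j\<in>set xs. z j ^ e m j)) \<le> C"
      proof -
        have "cmod (\<Sum>m\<in>I. c m * (\<Prod>j\<in>set (i # xs). (z(i := w)) j ^ e m j)) \<le> C"
          by (rule Cons.prems(4)) (use z w in auto)
        then show ?thesis by (simp only: prod_eq mult.assoc)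
      qed
    qed (use Cons.prems in auto)
    then show "norm (\<Sum>m\<in>I. w ^ e m i *\<^sub>C c m *\<^sub>C mon xs (e m) U v) \<le> C * norm v"
      by (simp add: scaleC_scaleC mult.commute)
  qed
  then show ?case by (simp add: mon_Cons cm)
qed

section \<open>Estimates on the polydisc\<close>

lemma norm_deriv_le_of_bounded_disc:
  assumes hol: "f holomorphic_on UNIV" and bound: "\<And>z. cmod z \<le> 1 \<Longrightarrow> cmod (f z) \<le> C"
    and a: "cmod a < 1"
  shows "(1 - (cmod a)\<^sup>2) * cmod (deriv f a) \<le> C"
proof -
  txt \<open>Cauchy's inequality at \<open>0\<close> for \<open>f \<circ> \<phi>\<close>, where \<open>\<phi>\<close> is the disc automorphism with \<open>\<phi> 0 = a\<close>.\<close>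
  define \<phi> where "\<phi> w = (w + a) / (1 + cnj a * w)" for w
  have nz: "1 + cnj a * w \<noteq> 0" if "cmod w \<le> 1" for w
  proof
    assume "1 + cnj a * w = 0"
    then have "cnj a * w = -1" by (metis add_eq_0_iff)
    then have "cmod a * cmod w = 1" by (metis complex_mod_cnj norm_minus_cancel norm_mult norm_one)
    moreover have "cmod a * cmod w \<le> cmod a * 1" using that by (intro mult_left_mono) auto
    ultimately show False using a by simp
  qed
  \<comment> \<open>Cauchy's inequality needs the bound only on the unit circle, where
    \<open>1 + cnj a * w = w * cnj (w + a)\<close>; numerator and denominator of
    \<open>\<phi> w\<close> thus have equal modulus.\<close>
  have disc: "cmod (\<phi> w) \<le> 1" if w: "cmod w = 1" for w
  proof -
    have ww: "w * cnj w = 1" using w by (simp add: complex_norm_square[symmetric])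
    have "cmod (1 + cnj a * w) = cmod (w * cnj (w + a))"
      using ww by (simp add: algebra_simps)
    also have "\<dots> = cmod (w + a)" by (simp only: norm_mult w complex_mod_cnj mult_1)
    finally show ?thesis by (simp add: \<phi>_def norm_divide)
  qed
  have d\<phi>: "(\<phi> has_field_derivative (1 - (cmod a)\<^sup>2)) (at 0)"
  proof -
    have "((\<lambda>w. w + a) has_field_derivative 1) (at 0)"
      "((\<lambda>w. 1 + cnj a * w) has_field_derivative cnj a) (at 0)"
      by (auto intro!: derivative_eq_intros)
    from DERIV_divide[OF this] show ?thesis
      by (simp add: \<phi>_def[abs_def] complex_norm_square flip: of_real_power)
  qed
  have df: "(f has_field_derivative deriv f a) (at (\<phi> 0))"
    using hol by (simp add: \<phi>_def holomorphic_derivI)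
  have "((\<lambda>w. f (\<phi> w)) has_field_derivative deriv f a * (1 - (cmod a)\<^sup>2)) (at 0)"
    by (rule DERIV_chain2[OF df d\<phi>])
  then have d: "deriv (\<lambda>w. f (\<phi> w)) 0 = deriv f a * (1 - (cmod a)\<^sup>2)"
    by (rule DERIV_imp_deriv)
  have "\<phi> holomorphic_on cball 0 1"
    unfolding \<phi>_def by (intro holomorphic_intros) (auto simp: nz)
  then have h: "(\<lambda>w. f (\<phi> w)) holomorphic_on cball 0 1"
    using holomorphic_on_compose_gen[OF _ hol, unfolded o_def] by blast
  have "cmod ((deriv ^^ 1) (\<lambda>w. f (\<phi> w)) 0) \<le> fact 1 * C / 1 ^ 1"
  proof (rule Cauchy_inequality)
    show "(\<lambda>w. f (\<phi> w)) holomorphic_on ball 0 1"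
      using h ball_subset_cball by (rule holomorphic_on_subset)
    show "continuous_on (cball 0 1) (\<lambda>w. f (\<phi> w))"
      using h by (rule holomorphic_on_imp_continuous_on)
  qed (auto intro!: bound disc)
  then have "cmod (deriv f a * complex_of_real (1 - (cmod a)\<^sup>2)) \<le> C"
    using d by simp
  moreover have "(cmod a)\<^sup>2 \<le> 1" using a by (simp add: power_le_one)
  ultimately show ?thesis
    unfolding norm_mult norm_of_real by (simp add: mult.commute)
qed

text \<open>The supremum defining \<open>poly_norm\<close> is over the open polydisc; the boundary
  is reached by continuity along \<open>t n\<close> times \<open>z\<close> with \<open>t n\<close>
  increasing to 1.\<close>

lemma poly_eval_le_closed_polydisc:
  assumes z: "\<And>i. i \<in> {1..d} \<Longrightarrow> cmod (z i) \<le> 1"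
  shows "cmod (poly_eval d p z) \<le> poly_norm d p"
proof (rule LIMSEQ_le_const2)
  define t where "t n = 1 - inverse (real (Suc n))" for n
  have "t \<longlonglongrightarrow> 1 - 0"
    unfolding t_def by (intro tendsto_intros LIMSEQ_inverse_real_of_nat)
  then have "(\<lambda>n. cmod (poly_eval d p (\<lambda>i. of_real (t n) * z i))) \<longlonglongrightarrow>
      cmod (poly_eval d p (\<lambda>i. of_real 1 * z i))"
    unfolding poly_eval_def by (intro tendsto_intros) simp
  then show "(\<lambda>n. cmod (poly_eval d p (\<lambda>i. of_real (t n) * z i))) \<longlonglongrightarrow> cmod (poly_eval d p z)"
    by simp
  have "cmod (poly_eval d p (\<lambda>i. of_real (t n) * z i)) \<le> poly_norm d p" for n
  proof -
    \<comment> \<open>Points of \<open>polydisc d\<close> are extensional functions, hence the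
      restriction.\<close>
    define w where "w = restrict (\<lambda>i. of_real (t n) * z i) {1..d}"
    have t: "0 \<le> t n" "t n < 1" by (auto simp: t_def inverse_le_1_iff)
    have "cmod (of_real (t n) * z i) < 1" if "i \<in> {1..d}" for i
    proof -
      have "t n * cmod (z i) \<le> t n * 1" by (rule mult_left_mono) (use z that t in auto)
      then show ?thesis using t by (simp add: norm_mult)
    qed
    then have "w \<in> polydisc d" by (simp add: w_def polydisc_def)
    then have "cmod (poly_eval d p w) \<le> poly_norm d p"
      unfolding poly_norm_def by (rule cSUP_upper[OF _ bdd_above_poly_eval])
    moreover have "poly_eval d p w = poly_eval d p (\<lambda>i. of_real (t n) * z i)"
      unfolding poly_eval_def w_def by (intro sum.cong prod.cong arg_cong2[of _ _ _ _ "(*)"]) auto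
    ultimately show ?thesis by simp
  qed
  then show "\<exists>N. \<forall>n\<ge>N. cmod (poly_eval d p (\<lambda>i. of_real (t n) * z i)) \<le> poly_norm d p"
    by blast
qed

text \<open>With all variables except the \<open>j\<close>-th frozen, \<open>p\<close> becomes an
  entire function \<open>f\<close> bounded by \<open>poly_norm d p\<close> on the closed disc. The
  sum is its derivative at \<open>u j\<close>, a point of modulus \<open>r j\<close>, and the
  Schwarz-Pick estimate applies there.\<close>

lemma poly_partial_deriv_bound:
  assumes j: "j \<in> {1..d}" and r: "\<And>i. i \<in> {1..d} \<Longrightarrow> r i \<in> {0..1}" and rj: "r j < 1"
    and z: "\<And>i. i \<in> {1..d} \<Longrightarrow> cmod (z i) = 1"
  defines "u \<equiv> \<lambda>i. complex_of_real (r i) * z i"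
  shows "(1 - (r j)\<^sup>2) * cmod (\<Sum>m\<in>Poly_Mapping.keys p. Poly_Mapping.lookup p m *
      (of_nat (Poly_Mapping.lookup m j) *
       (\<Prod>i\<in>{1..d}. u i ^ ((Poly_Mapping.lookup m)(j := Poly_Mapping.lookup m j - 1)) i)))
    \<le> poly_norm d p"
proof -
  define f where "f w = poly_eval d p (u(j := w))" for w
  define R where "R m = (\<Prod>i\<in>{1..d} - {j}. u i ^ Poly_Mapping.lookup m i)" for m
  have split: "(\<Prod>i\<in>{1..d}. g i) = g j * (\<Prod>i\<in>{1..d} - {j}. g i)" for g :: "nat \<Rightarrow> complex"
    using j by (intro prod.remove) auto
  have f: "f = (\<lambda>w. \<Sum>m\<in>Poly_Mapping.keys p. Poly_Mapping.lookup p m * (w ^ Poly_Mapping.lookup m j * R m))"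
    unfolding f_def poly_eval_def split R_def by (intro ext sum.cong refl) simp
  have "(f has_field_derivative (\<Sum>m\<in>Poly_Mapping.keys p. Poly_Mapping.lookup p m *
      (of_nat (Poly_Mapping.lookup m j) * (w ^ (Poly_Mapping.lookup m j - 1) * R m)))) (at w)" for w
    unfolding f by (auto intro!: derivative_eq_intros sum.cong)
  then have "deriv f (u j) = (\<Sum>m\<in>Poly_Mapping.keys p. Poly_Mapping.lookup p m *
      (of_nat (Poly_Mapping.lookup m j) * (u j ^ (Poly_Mapping.lookup m j - 1) * R m)))"
    by (rule DERIV_imp_deriv)
  also have "\<dots> = (\<Sum>m\<in>Poly_Mapping.keys p. Poly_Mapping.lookup p m *
      (of_nat (Poly_Mapping.lookup m j) *
       (\<Prod>i\<in>{1..d}. u i ^ ((Poly_Mapping.lookup m)(j := Poly_Mapping.lookup m j - 1)) i)))"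
    unfolding split R_def by (intro sum.cong refl) simp
  finally have d: "deriv f (u j) = \<dots>" .
  have u: "cmod (u i) = r i" if "i \<in> {1..d}" for i
    using r[OF that] z[OF that] by (simp add: u_def norm_mult)
  have "(1 - (cmod (u j))\<^sup>2) * cmod (deriv f (u j)) \<le> poly_norm d p"
  proof (rule norm_deriv_le_of_bounded_disc)
    show "f holomorphic_on UNIV" unfolding f by (intro holomorphic_intros)
    show "cmod (f w) \<le> poly_norm d p" if "cmod w \<le> 1" for w
      unfolding f_def using that u r by (intro poly_eval_le_closed_polydisc) auto
    show "cmod (u j) < 1" using u[OF j] rj by simp
  qed
  then show ?thesis unfolding d u[OF j] .
qed

section \<open>Block operators\<close>

lemma block_contraction_off_diagonal:
  fixes W :: "'k::chilbert_space \<Rightarrow> 'k" and H :: "'h::complex_inner \<Rightarrow> 'k"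
  assumes V: "lin_isometry V" and W: "lin_coisometry W" and H: "bounded_clinear H"
    and r: "r \<in> {0..1}" and T: "contraction (block_op r V H W)"
  shows "norm (H x) \<le> (1 - r\<^sup>2) * norm x"
proof -
  have contr: "norm (block_op r V H W u) \<le> norm u" for u
  proof -
    have "norm (block_op r V H W u) \<le> onorm (block_op r V H W) * norm u"
      using T by (intro onorm) (simp add: contraction_def bounded_clinear_def)
    also have "\<dots> \<le> 1 * norm u" using T by (intro mult_right_mono) (auto simp: contraction_def)
    finally show ?thesis by simp
  qed
  have bW: "bounded_clinear W" and bS: "bounded_clinear (cadjoint W)"
    using W by (auto simp: lin_coisometry_def lin_isometry_def)
  txt \<open>Test the contraction on \<open>(x, t W\<^sup>* H x)\<close>; the optimal choice is \<open>t = r / (1 - r\<^sup>2)\<close>.\<close>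
  have main: "(r * norm x)\<^sup>2 + ((1 + r * t) * norm (H x))\<^sup>2 \<le> (norm x)\<^sup>2 + (t * norm (H x))\<^sup>2"
    if t: "0 \<le> t" for t
  proof -
    \<comment> \<open>Since the adjoint is a right inverse of \<open>W\<close>, both contributions
      to the lower component are nonnegative multiples of \<open>H x\<close> and reinforce each
      other.\<close>
    have "block_op r V H W (x, t *\<^sub>R cadjoint W (H x)) = (r *\<^sub>R V x, (1 + r * t) *\<^sub>R H x)"
      by (simp add: block_op_def bounded_clinear_scaleR[OF bW] coisometry_right_inverse[OF W]
          scaleR_add_left)
    then have "norm (r *\<^sub>R V x, (1 + r * t) *\<^sub>R H x) \<le> norm (x, t *\<^sub>R cadjoint W (H x))"
      using contr by metis
    then show ?thesis
      using V r t unfolding norm_Pair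
      by (simp add: lin_isometry_def coisometry_right_inverse[OF W] real_sqrt_le_iff)
  qed
  show ?thesis
  proof (cases "r = 1")
    \<comment> \<open>Already \<open>t = 0\<close> forces \<open>H x = 0\<close>; the optimal
      \<open>t\<close> would have denominator 0 here.\<close>
    case True
    then show ?thesis using main[of 0] by simp
  next
    case False
    define s where "s = 1 - r\<^sup>2"
    have s: "s > 0" using False r by (simp add: s_def power_less_one_iff abs_square_less_1)
    \<comment> \<open>This is the net coefficient of the squared norm of \<open>H x\<close> in
      \<open>main\<close> at the optimal \<open>t\<close>.\<close>
    have "(1 + r * (r / s))\<^sup>2 - (r / s)\<^sup>2 = 1 / s"
    proof -
      have "1 + r * (r / s) = 1 / s" using s by (simp add: s_def field_simps power2_eq_square)
      moreover have "(1 / s)\<^sup>2 - (r / s)\<^sup>2 = s / s\<^sup>2"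
        by (simp add: power_divide s_def diff_divide_distrib)
      ultimately show ?thesis using s by (simp add: power2_eq_square)
    qed
    moreover have "(norm (H x))\<^sup>2 * ((1 + r * (r / s))\<^sup>2 - (r / s)\<^sup>2) \<le> s * (norm x)\<^sup>2"
    proof -
      have "0 \<le> r / s" using r s by simp
      from main[OF this] show ?thesis
        by (simp only: power_mult_distrib s_def left_diff_distrib right_diff_distrib mult.commute)
    qed
    ultimately have "(norm (H x))\<^sup>2 / s \<le> s * (norm x)\<^sup>2" by simp
    then have "(norm (H x))\<^sup>2 \<le> (s * norm x)\<^sup>2"
      using s by (simp add: divide_le_eq power2_eq_square mult_ac)
    then show ?thesis
      using s unfolding s_def by (meson less_imp_le mult_nonneg_nonneg norm_ge_zero power2_le_imp_le)
  qed
qed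

text \<open>Expanding the power, the corner collects the \<open>n\<close> words with exactly one
  factor \<open>H\<close>; by the intertwining relation all of them equal the same multiple of
  \<open>H\<close> after \<open>V ^^ (n - 1)\<close>. This is the derivative of the
  \<open>n\<close>-th power at \<open>rV\<close>.\<close>

lemma funpow_block_op:
  fixes V :: "'h::complex_inner \<Rightarrow> 'h" and W :: "'k::complex_inner \<Rightarrow> 'k"
  assumes V: "bounded_clinear V" and H: "bounded_clinear H" and W: "bounded_clinear W"
    and HV: "H \<circ> V = W \<circ> H"
  shows "(block_op r V H W ^^ n) (x, y) =
    (r ^ n *\<^sub>R (V ^^ n) x,
     (real n * r ^ (n - 1)) *\<^sub>R H ((V ^^ (n - 1)) x) + r ^ n *\<^sub>R (W ^^ n) y)"
proof (induction n)
  case (Suc n)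
  have WH: "W (H ((V ^^ (n - 1)) x)) = H ((V ^^ n) x)" if "n > 0"
    using that HV by (cases n) (auto simp: fun_eq_iff)
  show ?case
  proof (cases "n = 0")
    case True
    then show ?thesis by (simp add: block_op_def)
  next
    case False
    then have "r * (real n * r ^ (n - 1)) = real n * r ^ n"
      by (cases n) auto
    with False Suc WH show ?thesis
      by (simp add: block_op_def bounded_clinear_scaleR[OF V] bounded_clinear_scaleR[OF H]
          bounded_clinear_scaleR[OF W] bounded_clinear_add[OF W] scaleR_add_right)
        (simp add: algebra_simps)
  qed
qed (simp add: block_op_def)

text \<open>The \<open>j\<close>-th summand of the corner entry is \<open>H\<^sub>j\<close> applied to the \<open>j\<close>-th partial
  derivative of the monomial at \<open>rV\<close>; the exponent \<open>m j - 1\<close> is truncated at \<open>0\<close>, where the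
  factor \<open>m j\<close> vanishes.\<close>

lemma mon_block_op:
  fixes V :: "nat \<Rightarrow> 'h::complex_inner \<Rightarrow> 'h" and W :: "nat \<Rightarrow> 'k::complex_inner \<Rightarrow> 'k"
  assumes "distinct xs"
    and V: "\<And>i. i \<in> set xs \<Longrightarrow> bounded_clinear (V i)"
    and H: "\<And>i. i \<in> set xs \<Longrightarrow> bounded_clinear (H i)"
    and W: "\<And>i. i \<in> set xs \<Longrightarrow> bounded_clinear (W i)"
    and HV: "\<And>i j. i \<in> set xs \<Longrightarrow> j \<in> set xs \<Longrightarrow> H i \<circ> V j = W j \<circ> H i"
    and T: "\<And>i. i \<in> set xs \<Longrightarrow> T i = block_op (r i) (V i) (H i) (W i)"
  shows "mon xs m T (x, y) =
    ((\<Prod>i\<in>set xs. r i ^ m i) *\<^sub>R mon xs m V x,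
     (\<Sum>j\<in>set xs. (real (m j) * (\<Prod>i\<in>set xs. r i ^ (m(j := m j - 1)) i)) *\<^sub>R
        H j (mon xs (m(j := m j - 1)) V x)) + (\<Prod>i\<in>set xs. r i ^ m i) *\<^sub>R mon xs m W y)"
  using assms
proof (induction xs)
  case (Cons i xs)
  have i: "i \<notin> set xs" using Cons.prems by simp
  note bV = Cons.prems(2)[of i, simplified] and bH = Cons.prems(3)[of i, simplified]
    and bW = Cons.prems(4)[of i, simplified]
    and HVi = Cons.prems(5)[of i i, OF list.set_intros(1) list.set_intros(1)]
  have eq: "(\<Prod>l\<in>set xs. r l ^ (m(i := n)) l) = (\<Prod>l\<in>set xs. r l ^ m l)"
    "mon xs (m(i := n)) V x = mon xs m V x" for n
  proof -
    show "(\<Prod>l\<in>set xs. r l ^ (m(i := n)) l) = (\<Prod>l\<in>set xs. r l ^ m l)"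
      using i by (intro prod.cong) auto
    have "mon ys (m(i := n)) V x = mon ys m V x" if "i \<notin> set ys" for ys
      using that by (induction ys) (auto simp: mon_Cons)
    then show "mon xs (m(i := n)) V x = mon xs m V x" using i by blast
  qed
  have WH: "(W i ^^ n) (H j v) = H j ((V i ^^ n) v)" if "j \<in> set xs" for j n v
    using that by (intro funpow_commute_apply[symmetric] Cons.prems(5)) auto
  have IH: "mon xs m T (x, y) =
    ((\<Prod>i\<in>set xs. r i ^ m i) *\<^sub>R mon xs m V x,
     (\<Sum>j\<in>set xs. (real (m j) * (\<Prod>i\<in>set xs. r i ^ (m(j := m j - 1)) i)) *\<^sub>R
        H j (mon xs (m(j := m j - 1)) V x)) + (\<Prod>i\<in>set xs. r i ^ m i) *\<^sub>R mon xs m W y)"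
    using Cons.prems by (intro Cons.IH) auto
  have bVn: "bounded_clinear (V i ^^ n)" and bWn: "bounded_clinear (W i ^^ n)" for n
    by (intro bounded_clinear_funpow bV bW)+
  have summand: "(W i ^^ m i) (r i ^ m i *\<^sub>R
      (real (m j) * (\<Prod>l\<in>set xs. r l ^ (m(j := m j - 1)) l)) *\<^sub>R
        H j (mon xs (m(j := m j - 1)) V x)) =
    (real (m j) * (\<Prod>l\<in>set (i # xs). r l ^ (m(j := m j - 1)) l)) *\<^sub>R
        H j (mon (i # xs) (m(j := m j - 1)) V x)" if j: "j \<in> set xs" for j
  proof -
    have "j \<noteq> i" using i j by blast
    then show ?thesis
      using i by (simp add: mon_Cons bounded_clinear_scaleR[OF bWn] WH[OF j] mult_ac)
  qed
  have "mon (i # xs) m T (x, y) = (block_op (r i) (V i) (H i) (W i) ^^ m i) (mon xs m T (x, y))"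
    using Cons.prems(6)[of i] by (simp add: mon_Cons)
  \<comment> \<open>Product rule: the corner of the \<open>i\<close>-th factor meets the diagonal
    entry for \<open>xs\<close> and gives the summand \<open>i\<close>; the lower diagonal entry of
    the \<open>i\<close>-th factor meets the corner for \<open>xs\<close> and gives the others, once
    \<open>W i\<close> is moved past \<open>H j\<close>.\<close>
  also have "\<dots> = ((\<Prod>i\<in>set (i # xs). r i ^ m i) *\<^sub>R mon (i # xs) m V x,
     (real (m i) * (\<Prod>l\<in>set (i # xs). r l ^ (m(i := m i - 1)) l)) *\<^sub>R
        H i (mon (i # xs) (m(i := m i - 1)) V x) +
     ((\<Sum>j\<in>set xs. (W i ^^ m i) (r i ^ m i *\<^sub>R
      (real (m j) * (\<Prod>l\<in>set xs. r l ^ (m(j := m j - 1)) l)) *\<^sub>R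
        H j (mon xs (m(j := m j - 1)) V x)))
      + (\<Prod>i\<in>set (i # xs). r i ^ m i) *\<^sub>R mon (i # xs) m W y))"
    unfolding IH funpow_block_op[OF bV bH bW HVi]
    using i eq
    by (simp add: mon_Cons bounded_clinear_scaleR[OF bWn] bounded_clinear_scaleR[OF bVn]
        bounded_clinear_add[OF bWn] bounded_clinear_scaleR[OF bH] bounded_clinear_sum_apply[OF bWn]
        scaleR_add_right scaleR_sum_right del: fun_upd_apply)
      (simp add: mult_ac)
  also have "(\<Sum>j\<in>set xs. (W i ^^ m i) (r i ^ m i *\<^sub>R
      (real (m j) * (\<Prod>l\<in>set xs. r l ^ (m(j := m j - 1)) l)) *\<^sub>R
        H j (mon xs (m(j := m j - 1)) V x))) =
    (\<Sum>j\<in>set xs. (real (m j) * (\<Prod>l\<in>set (i # xs). r l ^ (m(j := m j - 1)) l)) *\<^sub>R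
        H j (mon (i # xs) (m(j := m j - 1)) V x))"
    by (intro sum.cong refl summand)
  finally show ?case
    using i by (simp add: add.assoc del: fun_upd_apply)
qed simp

section \<open>Assembling diagonal and corner estimates\<close>

theorem proposition3p10:
  fixes d :: nat
    and V :: "nat \<Rightarrow> 'h::chilbert_space \<Rightarrow> 'h"
    and W :: "nat \<Rightarrow> 'k::chilbert_space \<Rightarrow> 'k"
    and H :: "nat \<Rightarrow> 'h \<Rightarrow> 'k"
    and r :: "nat \<Rightarrow> real"
    and T :: "nat \<Rightarrow> 'h \<times> 'k \<Rightarrow> 'h \<times> 'k"
    and p :: "(nat \<Rightarrow>\<^sub>0 nat) \<Rightarrow>\<^sub>0 complex"
  assumes "1 \<le> d"
    and "\<And>i. i \<in> {1..d} \<Longrightarrow> lin_isometry (V i)"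
    and "\<And>i j. i \<in> {1..d} \<Longrightarrow> j \<in> {1..d} \<Longrightarrow> V i \<circ> V j = V j \<circ> V i"
    and "\<And>i. i \<in> {1..d} \<Longrightarrow> lin_coisometry (W i)"
    and "\<And>i j. i \<in> {1..d} \<Longrightarrow> j \<in> {1..d} \<Longrightarrow> W i \<circ> W j = W j \<circ> W i"
    and "\<And>i. i \<in> {1..d} \<Longrightarrow> bounded_clinear (H i)"
    and "\<And>i j. i \<in> {1..d} \<Longrightarrow> j \<in> {1..d} \<Longrightarrow> H i \<circ> V j = W j \<circ> H i"
    and "\<And>j. j \<in> {1..d} \<Longrightarrow> r j \<in> {0..1}"
    and "\<And>j. j \<in> {1..d} \<Longrightarrow> T j = block_op (r j) (V j) (H j) (W j)"
    and "\<And>j. j \<in> {1..d} \<Longrightarrow> contraction (T j)"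
    and "p \<in> polys d"
  shows "onorm (poly_op d p T) \<le> (real d + 1) * poly_norm d p"
proof -
  note V = assms(2) and VV = assms(3) and W = assms(4) and WW = assms(5) and H = assms(6)
    and HV = assms(7) and r = assms(8) and T = assms(9) and contr = assms(10)
  define C where "C = poly_norm d p"
  define K where "K = Poly_Mapping.keys p"
  define xs where "xs = [1..<Suc d]"
  have xs: "set xs = {1..d}" "distinct xs" by (auto simp: xs_def)
  define c where "c = Poly_Mapping.lookup p"
  define e :: "(nat \<Rightarrow>\<^sub>0 nat) \<Rightarrow> nat \<Rightarrow> nat" where "e = Poly_Mapping.lookup"
  \<comment> \<open>The exponents \<open>\<delta> j m\<close> are those of the \<open>j\<close>-th
    partial derivative of the monomial \<open>m\<close>. The scalar \<open>\<rho> n\<close> is the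
    ratio of a monomial at \<open>rV\<close> to the one at \<open>V\<close>; putting it into the
    coefficients lets von Neumann's inequality be applied to the isometries and co-isometries
    themselves.\<close>
  define \<delta> where "\<delta> j m = (e m)(j := e m j - 1)" for j m
  define \<rho> where "\<rho> n = (\<Prod>i\<in>{1..d}. r i ^ n i)" for n :: "nat \<Rightarrow> nat"
  have bV: "bounded_clinear (V i)" and bW: "bounded_clinear (W i)" if "i \<in> {1..d}" for i
    using V[OF that] W[OF that] by (auto simp: lin_isometry_def lin_coisometry_def)
  have C0: "0 \<le> C"
    using order_trans[OF norm_ge_zero poly_eval_le_closed_polydisc[of d "\<lambda>_. 0" p]]
    by (simp add: C_def)
  have \<rho>_prod: "complex_of_real (\<rho> n) * (\<Prod>i\<in>{1..d}. z i ^ n i) =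
      (\<Prod>i\<in>{1..d}. (of_real (r i) * z i) ^ n i)" for n z
    by (simp add: \<rho>_def power_mult_distrib prod.distrib)
  have diag: "cmod (\<Sum>m\<in>K. (c m * of_real (\<rho> (e m))) * (\<Prod>i\<in>set xs. z i ^ e m i)) \<le> C"
    if z: "\<And>i. i \<in> set xs \<Longrightarrow> cmod (z i) = 1" for z
  proof -
    have "cmod (poly_eval d p (\<lambda>i. of_real (r i) * z i)) \<le> C"
      unfolding C_def
      by (rule poly_eval_le_closed_polydisc) (use r z xs in \<open>auto simp: norm_mult\<close>)
    then show ?thesis
      unfolding poly_eval_def xs by (simp only: mult.assoc \<rho>_prod K_def c_def e_def)
  qed
  \<comment> \<open>\<open>P\<close>, \<open>Q\<close> and \<open>G j\<close> are
    \<open>p(rV)\<close>, \<open>p(rW)\<close> and the \<open>j\<close>-th partial derivative of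
    \<open>p\<close> at \<open>rV\<close>.\<close>
  define P where "P x = (\<Sum>m\<in>K. (c m * of_real (\<rho> (e m))) *\<^sub>C mon xs (e m) V x)" for x
  define Q where "Q y = (\<Sum>m\<in>K. (c m * of_real (\<rho> (e m))) *\<^sub>C mon xs (e m) W y)" for y
  define G where "G j x = (\<Sum>m\<in>K. (c m * (of_nat (e m j) * of_real (\<rho> (\<delta> j m)))) *\<^sub>C
      mon xs (\<delta> j m) V x)" for j x
  have K: "finite K" by (simp add: K_def)
  have P: "norm (P x) \<le> C * norm x" for x
    unfolding P_def by (rule von_neumann_commuting[OF K xs(2) _ _ diag]) (use V VV xs in auto)
  have Q: "norm (Q y) \<le> C * norm y" for y
    unfolding Q_def by (rule von_neumann_commuting[OF K xs(2) _ _ diag]) (use W WW xs in auto)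
  have HG: "norm (H j (G j x)) \<le> C * norm x" if j: "j \<in> {1..d}" for j x
  proof -
    have Hj: "norm (H j v) \<le> (1 - (r j)\<^sup>2) * norm v" for v
      by (rule block_contraction_off_diagonal[OF V[OF j] W[OF j] H[OF j] r[OF j]])
        (use T[OF j] contr[OF j] in simp)
    show ?thesis
    \<comment> \<open>For \<open>r j = 1\<close> there is no derivative bound, but then
      \<open>H j\<close> vanishes. Otherwise the factor \<open>1 - (r j)\<^sup>2\<close> from
      \<open>H j\<close> cancels the denominator in the bound for \<open>G j\<close>.\<close>
    proof (cases "r j = 1")
      case True
      then show ?thesis using Hj[of "G j x"] C0 by simp
    next
      case False
      with r[OF j] have rj: "r j < 1" by simp
      then have s: "0 < 1 - (r j)\<^sup>2"
        using r[OF j] by (simp add: power_less_one_iff abs_square_less_1)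
      have "norm (G j x) \<le> (C / (1 - (r j)\<^sup>2)) * norm x"
        unfolding G_def
      proof (rule von_neumann_commuting[OF K xs(2)])
        fix z assume z: "\<And>i. i \<in> set xs \<Longrightarrow> cmod (z i) = 1"
        have "(1 - (r j)\<^sup>2) * cmod (\<Sum>m\<in>K. c m * (of_nat (e m j) *
            (\<Prod>i\<in>{1..d}. (of_real (r i) * z i) ^ \<delta> j m i))) \<le> C"
          unfolding C_def K_def c_def e_def \<delta>_def
          by (rule poly_partial_deriv_bound) (use j r rj z xs in auto)
        then show "cmod (\<Sum>m\<in>K. c m * (of_nat (e m j) * of_real (\<rho> (\<delta> j m))) *
            (\<Prod>i\<in>set xs. z i ^ \<delta> j m i)) \<le> C / (1 - (r j)\<^sup>2)"
          unfolding xs mult.assoc \<rho>_prod using s by (simp add: pos_le_divide_eq mult.commute)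
      qed (use V VV xs in auto)
      then have "(1 - (r j)\<^sup>2) * norm (G j x) \<le> C * norm x"
        using s by (simp add: field_simps)
      then show ?thesis using Hj[of "G j x"] by linarith
    qed
  qed
  have decomp: "poly_op d p T (x, y) = (P x, (\<Sum>j\<in>{1..d}. H j (G j x)) + Q y)" for x y
  proof -
    have fst_sum: "(\<Sum>m\<in>M. (f m, g m)) = (sum f M, sum g M)"
      for M and f :: "_ \<Rightarrow> 'h" and g :: "_ \<Rightarrow> 'k"
      by (simp add: prod_eq_iff fst_sum snd_sum)
    have "poly_op d p T (x, y) = (\<Sum>m\<in>K. c m *\<^sub>C mon xs (e m) T (x, y))"
      by (simp add: poly_op_def monom_op_def mon_def K_def c_def e_def xs_def)
    also have "\<dots> = (\<Sum>m\<in>K. c m *\<^sub>C (\<rho> (e m) *\<^sub>R mon xs (e m) V x,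
        (\<Sum>j\<in>{1..d}. (real (e m j) * \<rho> (\<delta> j m)) *\<^sub>R H j (mon xs (\<delta> j m) V x)) +
        \<rho> (e m) *\<^sub>R mon xs (e m) W y))"
      unfolding \<rho>_def \<delta>_def xs(1)[symmetric]
      by (subst mon_block_op[OF xs(2), where V = V and H = H and W = W and r = r])
        (use bV bW H HV T xs in auto)
    also have "\<dots> = (\<Sum>m\<in>K. ((c m * of_real (\<rho> (e m))) *\<^sub>C mon xs (e m) V x,
        (\<Sum>j\<in>{1..d}. (c m * (of_nat (e m j) * of_real (\<rho> (\<delta> j m)))) *\<^sub>C H j (mon xs (\<delta> j m) V x)) +
        (c m * of_real (\<rho> (e m))) *\<^sub>C mon xs (e m) W y))"
      by (simp add: scaleC_prod_def scaleR_scaleC scaleC_scaleC scaleC_add_right scaleC_sum_right)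
    also have "\<dots> = (P x, (\<Sum>j\<in>{1..d}. H j (G j x)) + Q y)"
    proof -
      have "(\<Sum>m\<in>K. \<Sum>j\<in>{1..d}. (c m * (of_nat (e m j) * of_real (\<rho> (\<delta> j m)))) *\<^sub>C
          H j (mon xs (\<delta> j m) V x)) = (\<Sum>j\<in>{1..d}. H j (G j x))"
        unfolding G_def
        by (subst sum.swap) (intro sum.cong refl,
            simp add: bounded_clinear_sum_apply[OF H] bounded_clinear_scaleC[OF H])
      then show ?thesis
        by (simp add: fst_sum sum.distrib P_def Q_def)
    qed
    finally show ?thesis .
  qed
  have "norm (poly_op d p T u) \<le> (real d + 1) * C * norm u" for u
  proof (cases u)
    case (Pair x y)
    \<comment> \<open>Keeping the diagonal part together makes \<open>P\<close> and \<open>Q\<close>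
      cost \<open>C\<close> only once, as they act on orthogonal summands; each of the
      \<open>d\<close> corner terms costs another \<open>C\<close>.\<close>
    have "poly_op d p T u = (P x, Q y) + (0, \<Sum>j\<in>{1..d}. H j (G j x))"
      by (simp add: Pair decomp)
    then have "norm (poly_op d p T u) \<le> norm (P x, Q y) + norm (\<Sum>j\<in>{1..d}. H j (G j x))"
      using norm_triangle_ineq[of "(P x, Q y)" "(0, \<Sum>j\<in>{1..d}. H j (G j x))"]
      by (simp add: norm_Pair)
    moreover have "norm (P x, Q y) \<le> C * norm u"
    proof -
      have "norm (P x, Q y) \<le> sqrt ((C * norm x)\<^sup>2 + (C * norm y)\<^sup>2)"
        unfolding norm_Pair by (intro real_sqrt_le_mono add_mono power_mono P Q) auto
      also have "\<dots> = C * norm u"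
        unfolding Pair norm_Pair power_mult_distrib distrib_left[symmetric] real_sqrt_mult
        using C0 by simp
      finally show ?thesis .
    qed
    moreover have "norm (\<Sum>j\<in>{1..d}. H j (G j x)) \<le> real d * (C * norm u)"
    proof -
      have "norm x \<le> norm u" unfolding Pair by (rule norm_fst_le)
      then have "norm (H j (G j x)) \<le> C * norm u" if "j \<in> {1..d}" for j
        using HG[OF that, of x] mult_left_mono[OF _ C0] by (meson order_trans)
      then have "norm (\<Sum>j\<in>{1..d}. H j (G j x)) \<le> real (card {1..d}) * (C * norm u)"
        by (rule sum_norm_bound)
      then show ?thesis by simp
    qed
    ultimately show ?thesis by (simp add: algebra_simps)
  qed
  then show ?thesis
    unfolding C_def[symmetric] by (intro onorm_bound) (simp add: C0)
qed

end
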